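(* Let $\mathcal{M},\mathcal{N},\mathcal{S}$ be subspaces of $\mathcal{H}$. The following are equivalent: (i) there exists an idempotent linear relation $E$ on $\mathcal{H}$ such that $\mathcal{M}=\ker(I-E)$, $\mathcal{N}=\ker E$ and $\mathcal{S}=\operatorname{mul}E$; (ii) $(\mathcal{M}+\mathcal{N})\cap\mathcal{S}=\mathcal{M}\cap\mathcal{N}$; (iii) $(\mathcal{M}+\mathcal{N})\cap(\mathcal{M}+\mathcal{S})=\mathcal{M}$ and $\mathcal{M}\cap\mathcal{N}=\mathcal{M}\cap\mathcal{S}$. In this case, $E=P_{\mathcal{M},\mathcal{N}}\ \hat{+}\ (\{0\}\times\mathcal{S})$ is the unique idempotent linear relation satisfying the conditions in (i).
   Context: $\mathcal{H}$ is a complex separable Hilbert space; "subspace" means linear subspace, not necessarily closed. A linear relation on $\mathcal{H}$ is a linear subspace $E \subseteq \mathcal{H}\times\mathcal{H}$, with $\ker E=\{x:(x,0)\in E\}$, $\operatorname{mul}E=\{y:(0,y)\in E\}$. Product: $ST=\{(x,y): (x,z)\in T,\ (z,y)\in S \text{ for some } z\}$, and $E^2=EE$. $E$ is idempotent if $E^2=E$. $I=\{(u,u):u\in\mathcal{H}\}$ and $I-E=\{(x,x-y):(x,y)\in E\}$. $T\,\hat{+}\,S$ denotes the sum of $T$ and $S$ as linear subspaces of $\mathcal{H}\times\mathcal{H}$. For subspaces $\mathcal{M},\mathcal{N}$ of $\mathcal{H}$, $P_{\mathcal{M},\mathcal{N}}:=\{(m+n,m): m\in\mathcal{M},\ n\in\mathcal{N}\}$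 (a linear relation). *)

theory Defs
  imports "HOL-Analysis.Analysis"
begin

section \<open>Complex Hilbert spaces\<close>

text \<open>
  The library provides \<^class>\<open>real_vector\<close> and \<^class>\<open>real_inner\<close> only. A complex vector space is
  taken to be a real one carrying a compatible complex scalar multiplication, so that the library's
  norm and metric classes apply to it.
\<close>

class complex_vector = real_vector +
  fixes scaleC :: "complex \<Rightarrow> 'a \<Rightarrow> 'a"  (infixr \<open>*\<^sub>C\<close> 75)
  assumes scaleC_add_right: "a *\<^sub>C (x + y) = a *\<^sub>C x + a *\<^sub>C y"
    and scaleC_add_left: "(a + b) *\<^sub>C x = a *\<^sub>C x + b *\<^sub>C x"
    and scaleC_scaleC: "a *\<^sub>C b *\<^sub>C x = (a * b) *\<^sub>C x"
    and scaleC_one: "1 *\<^sub>C x = x"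
    and scaleR_eq_scaleC: "r *\<^sub>R x = complex_of_real r *\<^sub>C x"

global_interpretation cvec: vector_space "scaleC :: complex \<Rightarrow> 'a \<Rightarrow> 'a::complex_vector"
  by unfold_locales
    (simp_all add: scaleC_add_right scaleC_add_left scaleC_scaleC scaleC_one)

abbreviation csubspace :: "'a::complex_vector set \<Rightarrow> bool"
  where "csubspace \<equiv> cvec.subspace"

text \<open>The inner product is linear in its first argument.\<close>

class complex_inner = complex_vector + real_normed_vector +
  fixes cinner :: "'a \<Rightarrow> 'a \<Rightarrow> complex"
  assumes cinner_commute: "cinner x y = cnj (cinner y x)"
    and cinner_add_left: "cinner (x + y) z = cinner x z + cinner y z"
    and cinner_scaleC_left: "cinner (a *\<^sub>C x) y = a * cinner x y"
    and cinner_self_real: "cinner x x \<in> \<real>"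
    and cinner_self_nonneg: "0 \<le> Re (cinner x x)"
    and cinner_eq_zero_iff: "cinner x x = 0 \<longleftrightarrow> x = 0"
    and norm_eq_sqrt_cinner: "norm x = sqrt (Re (cinner x x))"

class complex_hilbert_space = complex_inner + complete_space

instantiation complex :: complex_hilbert_space
begin

definition scaleC_complex :: "complex \<Rightarrow> complex \<Rightarrow> complex"
  where "scaleC_complex = (*)"

definition cinner_complex :: "complex \<Rightarrow> complex \<Rightarrow> complex"
  where "cinner_complex x y = x * cnj y"

instance
proof
  fix x :: complex
  show "cinner x x \<in> \<real>"
    by (simp add: cinner_complex_def complex_is_Real_iff)
qed (auto simp: scaleC_complex_def cinner_complex_def algebra_simps scaleR_conv_of_real
    norm_complex_def power2_eq_square)

end

instantiation prod :: (complex_vector, complex_vector) complex_vector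
begin

definition scaleC_prod :: "complex \<Rightarrow> 'a \<times> 'b \<Rightarrow> 'a \<times> 'b"
  where "scaleC_prod c p = (c *\<^sub>C fst p, c *\<^sub>C snd p)"

instance
  by standard
    (simp_all add: scaleC_prod_def prod_eq_iff scaleC_add_right scaleC_add_left scaleC_scaleC
      scaleC_one scaleR_eq_scaleC)

end


section \<open>Linear relations\<close>

text \<open>
  A linear relation is a complex linear subspace of the product space. The sums of subspaces, both
  in the space and (for relations) in the product space, are the elementwise sums of sets
  \<open>A + B\<close> of theory \<^theory>\<open>HOL-Library.Set_Algebras\<close>.
\<close>

definition linear_relation :: "('a::complex_vector \<times> 'a) set \<Rightarrow> bool"
  where "linear_relation E \<longleftrightarrow> csubspace E"

definition rel_ker :: "('a::complex_vector \<times> 'a) set \<Rightarrow> 'a set"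
  where "rel_ker E = {x. (x, 0) \<in> E}"

definition rel_mul :: "('a::complex_vector \<times> 'a) set \<Rightarrow> 'a set"
  where "rel_mul E = {y. (0, y) \<in> E}"

text \<open>The right factor acts first, whereas relational composition \<open>O\<close> applies its left argument
  first.\<close>

definition rel_prod :: "('a \<times> 'a) set \<Rightarrow> ('a \<times> 'a) set \<Rightarrow> ('a \<times> 'a) set"
  where "rel_prod S T = T O S"

definition idempotent_relation :: "('a::complex_vector \<times> 'a) set \<Rightarrow> bool"
  where "idempotent_relation E \<longleftrightarrow> linear_relation E \<and> rel_prod E E = E"

definition id_minus :: "('a::complex_vector \<times> 'a) set \<Rightarrow> ('a \<times> 'a) set"
  where "id_minus E = {(x, x - y) |x y. (x, y) \<in> E}"

definition proj_rel :: "'a::complex_vector set \<Rightarrow> 'a set \<Rightarrow> ('a \<times> 'a) set"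
  where "proj_rel M N = {(m + n, m) |m n. m \<in> M \<and> n \<in> N}"

definition idempotent_with ::
    "('a::complex_vector \<times> 'a) set \<Rightarrow> 'a set \<Rightarrow> 'a set \<Rightarrow> 'a set \<Rightarrow> bool"
  where "idempotent_with E M N S \<longleftrightarrow>
    idempotent_relation E \<and> M = rel_ker (id_minus E) \<and> N = rel_ker E \<and> S = rel_mul E"

end

theory Submission
  imports Defs
begin

text \<open>
  Let \<open>E\<close> be idempotent with the given data. If \<open>(x, y) \<in> E\<close>, factor it as \<open>(x, z), (z, y) \<in> E\<close>;
  subtracting gives \<open>y - z \<in> mul E = S\<close>, hence \<open>(z, z) \<in> E\<close>, i.e. \<open>z \<in> M\<close>, and \<open>x - z \<in> ker E = N\<close>.
  So \<open>(x, y) = (z + (x - z), z) + (0, y - z)\<close>, which is uniqueness. The relation so described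
  is \<open>{(m + n, m + s)}\<close>; its square, kernel, fixed points and multivalued part are computed from
  coincidences such as \<open>m + s = m' + n'\<close>, and (ii) places \<open>s\<close>, and hence \<open>n'\<close>, in \<open>M \<inter> N\<close>.
  The equivalence of (ii) and (iii) is the modular law.
\<close>

lemma rel_ker_id_minus: "rel_ker (id_minus E) = {x. (x, x) \<in> E}"
  by (auto simp: rel_ker_def id_minus_def)

text \<open>With every condition expressed by membership of \<open>(x, x)\<close>,
  \<open>(x, 0)\<close> or \<open>(0, y)\<close>, the arguments below reduce to adding, subtracting
  and composing pairs.\<close>

lemma idempotent_with_iff:
  "idempotent_with E M N S \<longleftrightarrow> csubspace E \<and> E O E = E \<and>
    M = {x. (x, x) \<in> E} \<and> N = {x. (x, 0) \<in> E} \<and> S = {y. (0, y) \<in> E}"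
  unfolding idempotent_with_def idempotent_relation_def linear_relation_def rel_prod_def
    rel_ker_id_minus by (auto simp: rel_ker_def rel_mul_def)

lemma mem_proj_rel_plus_mul:
  "(x, y) \<in> proj_rel M N + {0} \<times> S \<longleftrightarrow>
    (\<exists>m\<in>M. \<exists>n\<in>N. \<exists>s\<in>S. x = m + n \<and> y = m + s)"
  unfolding proj_rel_def set_plus_def by fastforce

lemma csubspace_pairI:
  fixes E :: "('a::complex_vector \<times> 'b::complex_vector) set"
  assumes "(0, 0) \<in> E"
    and "\<And>x y x' y'. (x, y) \<in> E \<Longrightarrow> (x', y') \<in> E \<Longrightarrow> (x + x', y + y') \<in> E"
    and "\<And>c x y. (x, y) \<in> E \<Longrightarrow> (c *\<^sub>C x, c *\<^sub>C y) \<in> E"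
  shows "csubspace E"
  using assms by (auto simp: cvec.subspace_def zero_prod_def scaleC_prod_def)

lemma csubspace_pair_add:
  fixes E :: "('a::complex_vector \<times> 'b::complex_vector) set"
  shows "csubspace E \<Longrightarrow> (x, y) \<in> E \<Longrightarrow> (x', y') \<in> E \<Longrightarrow> (x + x', y + y') \<in> E"
  using cvec.subspace_add[of E "(x, y)" "(x', y')"] by simp

lemma csubspace_pair_diff:
  fixes E :: "('a::complex_vector \<times> 'b::complex_vector) set"
  shows "csubspace E \<Longrightarrow> (x, y) \<in> E \<Longrightarrow> (x', y') \<in> E \<Longrightarrow> (x - x', y - y') \<in> E"
  using cvec.subspace_diff[of E "(x, y)" "(x', y')"] by simp

lemma csubspace_proj_rel_plus_mul:
  fixes M N S :: "'a::complex_vector set"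
  assumes M: "csubspace M" and N: "csubspace N" and S: "csubspace S"
  shows "csubspace (proj_rel M N + {0} \<times> S)"
proof (rule csubspace_pairI)
  show "(0, 0) \<in> proj_rel M N + {0} \<times> S"
    unfolding mem_proj_rel_plus_mul
    using cvec.subspace_0[OF M] cvec.subspace_0[OF N] cvec.subspace_0[OF S] by force
next
  fix x y x' y'
  assume "(x, y) \<in> proj_rel M N + {0} \<times> S" "(x', y') \<in> proj_rel M N + {0} \<times> S"
  then obtain m n s m' n' s' where "m \<in> M" "n \<in> N" "s \<in> S" "m' \<in> M" "n' \<in> N" "s' \<in> S"
    and eq: "x = m + n" "y = m + s" "x' = m' + n'" "y' = m' + s'"
    unfolding mem_proj_rel_plus_mul by blast
  then have "m + m' \<in> M" "n + n' \<in> N" "s + s' \<in> S"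
    using cvec.subspace_add M N S by blast+
  moreover have "x + x' = (m + m') + (n + n')" "y + y' = (m + m') + (s + s')"
    using eq by simp_all
  ultimately show "(x + x', y + y') \<in> proj_rel M N + {0} \<times> S"
    unfolding mem_proj_rel_plus_mul by blast
next
  fix c x y
  assume "(x, y) \<in> proj_rel M N + {0} \<times> S"
  then obtain m n s where "m \<in> M" "n \<in> N" "s \<in> S" "x = m + n" "y = m + s"
    unfolding mem_proj_rel_plus_mul by blast
  moreover from this have "c *\<^sub>C m \<in> M" "c *\<^sub>C n \<in> N" "c *\<^sub>C s \<in> S"
    using cvec.subspace_scale M N S by blast+
  ultimately show "(c *\<^sub>C x, c *\<^sub>C y) \<in> proj_rel M N + {0} \<times> S"
    unfolding mem_proj_rel_plus_mul by (auto simp: scaleC_add_right)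
qed

lemma idempotent_with_imp_eq:
  fixes M N S :: "'a::complex_vector set"
  assumes "idempotent_with E M N S"
  shows "E = proj_rel M N + {0} \<times> S"
proof -
  have E: "csubspace E" and idem: "E O E = E" and M: "M = {x. (x, x) \<in> E}"
    and N: "N = {x. (x, 0) \<in> E}" and S: "S = {y. (0, y) \<in> E}"
    using assms by (auto simp: idempotent_with_iff)
  have "(x, y) \<in> E \<longleftrightarrow> (x, y) \<in> proj_rel M N + {0} \<times> S" for x y
  proof
    assume xy: "(x, y) \<in> E"
    then obtain z where xz: "(x, z) \<in> E" and zy: "(z, y) \<in> E"
      using idem by blast
    have s: "(0, y - z) \<in> E"
      using csubspace_pair_diff[OF E xy xz] by simp
    have m: "(z, z) \<in> E"
      using csubspace_pair_diff[OF E zy s] by simp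
    have "(x - z, 0) \<in> E"
      using csubspace_pair_diff[OF E xz m] by simp
    moreover have "x = z + (x - z)" "y = z + (y - z)"
      by simp_all
    ultimately show "(x, y) \<in> proj_rel M N + {0} \<times> S"
      unfolding mem_proj_rel_plus_mul using m s M N S by blast
  next
    assume "(x, y) \<in> proj_rel M N + {0} \<times> S"
    then obtain m n s where "(m, m) \<in> E" "(n, 0) \<in> E" "(0, s) \<in> E" "x = m + n" "y = m + s"
      unfolding mem_proj_rel_plus_mul M N S by blast
    then show "(x, y) \<in> E"
      using csubspace_pair_add[OF E csubspace_pair_add[OF E]] by fastforce
  qed
  then show ?thesis by auto
qed

text \<open>This is (i) implies (ii). The sum \<open>(m, m) + (n, 0)\<close> relates
  \<open>m + n\<close> to \<open>m\<close>, and idempotence transfers this to any preimage of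
  \<open>m + n\<close>, in particular to 0.\<close>

lemma idempotent_with_imp_inter:
  fixes M N S :: "'a::complex_vector set"
  assumes "idempotent_with E M N S"
  shows "(M + N) \<inter> S = M \<inter> N"
proof -
  have E: "csubspace E" and idem: "E O E = E" and M: "M = {x. (x, x) \<in> E}"
    and N: "N = {x. (x, 0) \<in> E}" and S: "S = {y. (0, y) \<in> E}"
    using assms by (auto simp: idempotent_with_iff)
  show ?thesis
  proof (intro equalityI subsetI)
    fix x
    assume "x \<in> (M + N) \<inter> S"
    then obtain m n where x: "x = m + n" and m: "(m, m) \<in> E" and n: "(n, 0) \<in> E"
      and s: "(0, x) \<in> E"
      using M N S by (auto elim: set_plus_elim)
    have "(x, m) \<in> E"
      using csubspace_pair_add[OF E m n] x by simp
    \<comment> \<open>Compose \<open>(0, x)\<close> with \<open>(x, m)\<close>; subtracting the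
      result from \<open>(m, m)\<close> then puts \<open>m\<close> in the kernel.\<close>
    then have "(0, m) \<in> E"
      using s idem by blast
    then have "(m, 0) \<in> E"
      using csubspace_pair_diff[OF E m] by fastforce
    then have x0: "(x, 0) \<in> E"
      using csubspace_pair_add[OF E _ n] x by fastforce
    then have "(x, x) \<in> E"
      using csubspace_pair_add[OF E x0 s] by simp
    then show "x \<in> M \<inter> N"
      using x0 M N by simp
  next
    fix x
    assume "x \<in> M \<inter> N"
    then have "(x, x) \<in> E" "(x, 0) \<in> E"
      using M N by auto
    then have "(0, x) \<in> E"
      using csubspace_pair_diff[OF E] by fastforce
    moreover have "(0, 0) \<in> E"
      using cvec.subspace_0[OF E] by (simp add: zero_prod_def)
    then have "x + 0 \<in> M + N"
      using \<open>x \<in> M \<inter> N\<close> N by (intro set_plus_intro) auto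
    ultimately show "x \<in> (M + N) \<inter> S"
      using S by simp
  qed
qed

text \<open>This is (ii) implies (i). The representation \<open>(m + n, m + s)\<close> of a pair
  need not be unique; (ii) confines the ambiguity to \<open>M \<inter> N\<close>, which lies in
  \<open>S\<close>.\<close>

lemma idempotent_with_proj_rel_plus_mul:
  fixes M N S :: "'a::complex_vector set"
  assumes M: "csubspace M" and N: "csubspace N" and S: "csubspace S"
    and inter: "(M + N) \<inter> S = M \<inter> N"
  shows "idempotent_with (proj_rel M N + {0} \<times> S) M N S"
proof -
  let ?E = "proj_rel M N + {0} \<times> S"
  note [simp] = cvec.subspace_0[OF M] cvec.subspace_0[OF N] cvec.subspace_0[OF S]
  \<comment> \<open>Taking \<open>m = 0\<close> or \<open>n = 0\<close> below gives
    \<open>N \<inter> S \<subseteq> M\<close> and \<open>M \<inter> S \<subseteq> N\<close>.\<close>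
  have MN: "x \<in> M" "x \<in> N" if "m \<in> M" "n \<in> N" "x = m + n" "x \<in> S" for x m n
    using that inter by (auto intro: set_plus_intro)
  have E: "(m + n, m + s) \<in> ?E" if "m \<in> M" "n \<in> N" "s \<in> S" for m n s
    using that unfolding mem_proj_rel_plus_mul by blast
  have "?E O ?E = ?E"
  proof (intro equalityI subrelI)
    fix x y
    assume "(x, y) \<in> ?E O ?E"
    then obtain z where "(x, z) \<in> ?E" "(z, y) \<in> ?E"
      by blast
    then obtain m n s m' n' s' where mem: "m \<in> M" "n \<in> N" "s \<in> S" "m' \<in> M" "n' \<in> N" "s' \<in> S"
      and x: "x = m + n" and z: "m + s = m' + n'" and y: "y = m' + s'"
      unfolding mem_proj_rel_plus_mul by metis
    \<comment> \<open>The two representations of the midpoint \<open>z\<close> put \<open>s\<close>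
      in \<open>(M + N) \<inter> S\<close>.\<close>
    have "s = (m' - m) + n'"
      using z by (simp add: algebra_simps)
    then have "s \<in> M"
      using MN(1)[of "m' - m" n' s] cvec.subspace_diff[OF M] mem by blast
    moreover have n': "n' = (m + s) - m'"
      using z by (simp add: algebra_simps)
    ultimately have "n' \<in> M"
      using cvec.subspace_diff[OF M] cvec.subspace_add[OF M] mem by blast
    then have "n' \<in> S"
      using inter mem by blast
    then have "s - n' + s' \<in> S"
      using cvec.subspace_diff[OF S] cvec.subspace_add[OF S] mem by blast
    \<comment> \<open>The \<open>M\<close>-component \<open>m\<close> of \<open>x\<close> is kept,
      and the correction \<open>m' - m = s - n'\<close> moves into the
      \<open>S\<close>-component.\<close>
    moreover have "y = m + (s - n' + s')"
      using y n' by (simp add: algebra_simps)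
    ultimately show "(x, y) \<in> ?E"
      using E x mem by blast
  next
    fix x y
    assume "(x, y) \<in> ?E"
    then obtain m n s where mem: "m \<in> M" "n \<in> N" "s \<in> S" "x = m + n" "y = m + s"
      unfolding mem_proj_rel_plus_mul by blast
    \<comment> \<open>The midpoint is \<open>m\<close>, first with zero \<open>S\<close>-component,
      then with zero \<open>N\<close>-component.\<close>
    then have "(x, m) \<in> ?E" "(m, y) \<in> ?E"
      using E[of m n 0] E[of m 0 s] by simp_all
    then show "(x, y) \<in> ?E O ?E"
      by blast
  qed
  moreover have "(x, x) \<in> ?E \<longleftrightarrow> x \<in> M" for x
  proof
    assume "(x, x) \<in> ?E"
    then obtain m n s where mem: "m \<in> M" "n \<in> N" "s \<in> S" and "x = m + n" "x = m + s"
      unfolding mem_proj_rel_plus_mul by blast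
    \<comment> \<open>Cancelling \<open>m\<close> gives \<open>n = s\<close>, so \<open>n\<close>
      lies in \<open>N \<inter> S\<close>.\<close>
    moreover from this have "n \<in> M"
      using MN(1)[of 0 n n] by simp
    ultimately show "x \<in> M"
      using cvec.subspace_add[OF M] by blast
  qed (use E[of x 0 0] in simp)
  moreover have "(x, 0) \<in> ?E \<longleftrightarrow> x \<in> N" for x
  proof
    assume "(x, 0) \<in> ?E"
    then obtain m n s where mem: "m \<in> M" "n \<in> N" "s \<in> S" and x: "x = m + n" and 0: "0 = m + s"
      unfolding mem_proj_rel_plus_mul by blast
    have "m \<in> S"
      using 0 cvec.subspace_neg[OF S \<open>s \<in> S\<close>] eq_neg_iff_add_eq_0[of m s] by metis
    then have "m \<in> N"
      using MN(2)[of m 0 m] mem by simp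
    then show "x \<in> N"
      using cvec.subspace_add[OF N] mem x by blast
  qed (use E[of 0 x 0] in simp)
  moreover have "(0, y) \<in> ?E \<longleftrightarrow> y \<in> S" for y
  proof
    assume "(0, y) \<in> ?E"
    then obtain m n s where mem: "m \<in> M" "n \<in> N" "s \<in> S" and 0: "0 = m + n" and y: "y = m + s"
      unfolding mem_proj_rel_plus_mul by blast
    have "m \<in> N"
      using 0 cvec.subspace_neg[OF N \<open>n \<in> N\<close>] eq_neg_iff_add_eq_0[of m n] by metis
    then have "m \<in> S"
      using inter mem by blast
    then show "y \<in> S"
      using cvec.subspace_add[OF S] mem y by blast
  qed (use E[of 0 0 y] in simp)
  ultimately show ?thesis
    using csubspace_proj_rel_plus_mul[OF M N S] by (simp add: idempotent_with_iff)
qed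

text \<open>Since \<open>M \<subseteq> M + N\<close>, the modular law turns
  \<open>(M + N) \<inter> (M + S)\<close> into \<open>M + (M + N) \<inter> S\<close>, which (ii)
  collapses to \<open>M\<close>.\<close>

lemma inter_eq_iff_modular:
  fixes M N S :: "'a::complex_vector set"
  assumes M: "csubspace M" and N: "csubspace N" and S: "csubspace S"
  shows "(M + N) \<inter> S = M \<inter> N \<longleftrightarrow> (M + N) \<inter> (M + S) = M \<and> M \<inter> N = M \<inter> S"
proof -
  have sub: "A \<subseteq> A + B" "B \<subseteq> A + B" if "csubspace A" "csubspace B" for A B :: "'a set"
    using set_zero_plus2[OF cvec.subspace_0, OF that(2), of A]
      set_zero_plus2[OF cvec.subspace_0, OF that(1), of B] by (simp_all add: add.commute)
  have modular: "(M + N) \<inter> (M + S) \<subseteq> M + (M + N) \<inter> S"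
  proof
    fix x
    assume "x \<in> (M + N) \<inter> (M + S)"
    then obtain m n m' s where mem: "m \<in> M" "n \<in> N" "m' \<in> M" "s \<in> S"
      and x: "x = m + n" "x = m' + s"
      by (metis IntE set_plus_elim)
    have s: "s = (m - m') + n"
      using x by (simp add: algebra_simps)
    have "s \<in> M + N"
      unfolding s using cvec.subspace_diff[OF M] mem by (intro set_plus_intro) auto
    then show "x \<in> M + (M + N) \<inter> S"
      unfolding x(2) using mem by (intro set_plus_intro) auto
  qed
  show ?thesis
  proof
    assume inter: "(M + N) \<inter> S = M \<inter> N"
    have "M + M \<inter> N \<subseteq> M"
      using cvec.subspace_add[OF M] by (auto elim: set_plus_elim)
    then have "(M + N) \<inter> (M + S) \<subseteq> M"
      using modular unfolding inter by (rule order_trans[rotated])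
    then have "(M + N) \<inter> (M + S) = M"
      using sub(1)[OF M N] sub(1)[OF M S] by (intro equalityI Int_greatest)
    then show "(M + N) \<inter> (M + S) = M \<and> M \<inter> N = M \<inter> S"
      using inter sub(1)[OF M N] by blast
  next
    assume "(M + N) \<inter> (M + S) = M \<and> M \<inter> N = M \<inter> S"
    then show "(M + N) \<inter> S = M \<inter> N"
      \<comment> \<open>From \<open>S \<subseteq> M + S\<close>, the set
        \<open>(M + N) \<inter> S\<close> lies in \<open>M\<close>, so it equals
        \<open>M \<inter> S\<close>, which is \<open>M \<inter> N\<close>.\<close>
      using sub(2)[OF M S] sub(1)[OF M N] by blast
  qed
qed

theorem proposition4p9:
  fixes M N S :: "'a::complex_hilbert_space set"
  assumes "separable_space (euclidean :: 'a topology)"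
    and "csubspace M" and "csubspace N" and "csubspace S"
  shows "((\<exists>E. idempotent_with E M N S) \<longleftrightarrow> (M + N) \<inter> S = M \<inter> N) \<and>
    ((M + N) \<inter> S = M \<inter> N \<longleftrightarrow> (M + N) \<inter> (M + S) = M \<and> M \<inter> N = M \<inter> S) \<and>
    ((\<exists>E. idempotent_with E M N S) \<longrightarrow>
      idempotent_with (proj_rel M N + {0} \<times> S) M N S \<and>
      (\<forall>E. idempotent_with E M N S \<longrightarrow> E = proj_rel M N + {0} \<times> S))"
proof -
  have "(\<exists>E. idempotent_with E M N S) \<longleftrightarrow> (M + N) \<inter> S = M \<inter> N"
    using idempotent_with_proj_rel_plus_mul[OF assms(2-4)] idempotent_with_imp_inter by blast
  \<comment> \<open>Any such \<open>E\<close> equals the explicit relation, which therefore inherits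
    its properties.\<close>
  moreover have "idempotent_with (proj_rel M N + {0} \<times> S) M N S" if "idempotent_with E M N S" for E
    using that idempotent_with_imp_eq[OF that] by simp
  ultimately show ?thesis
    using inter_eq_iff_modular[OF assms(2-4)] idempotent_with_imp_eq by blast
qed

end
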